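(* Let $\lambda>0$, let $\bm{M}^\star$ be the optimal solution of $\min_{\bm{M}\succeq\bm{O}}P_\lambda(\bm{M})$, let $\bm{M}\succeq\bm{O}$ be any feasible solution, let $\nabla P_\lambda(\bm{M})$ be any subgradient of $P_\lambda$ at $\bm{M}$, and put $\bm{Q}^{\mathrm{GB}}(\bm{M}):=\bm{M}-\frac{1}{2\lambda}\nabla P_{\lambda}(\bm{M})$. Then $$\left\|\bm{M}^\star-\left[\bm{Q}^{\mathrm{GB}}(\bm{M})\right]_+\right\|_F^2\le\left(\frac{1}{2\lambda}\left\|\nabla P_{\lambda}(\bm{M})\right\|_F\right)^2-\left\|\left[\bm{Q}^{\mathrm{GB}}(\bm{M})\right]_-\right\|_F^2.$$
   Context: Let $\bm{x}_1,\dots,\bm{x}_n\in\mathbb{R}^d$ have labels $y_1,\dots,y_n$ in a discrete set, and let $\mathcal{T}=\{(i,j,l)\in\{1,\dots,n\}^3\mid y_i=y_j,\ i\neq j,\ y_i\neq y_l\}$. For $(i,j,l)\in\mathcal{T}$ put $\bm{H}_{ijl}=(\bm{x}_i-\bm{x}_l)(\bm{x}_i-\bm{x}_l)^\top-(\bm{x}_i-\bm{x}_j)(\bm{x}_i-\bm{x}_j)^\top$. $\langle \bm{A},\bm{B}\rangle=\mathrm{tr}(\bm{A}^\top\bm{B})$, $\|\bm{A}\|_F^2=\langle\bm{A},\bm{A}\rangle$, and $\bm{M}\succeq\bm{O}$ means that $\bm{M}\in\mathbb{R}^{d\times d}$ is (symmetric) positive semi-definite. For a symmetric matrix $\bm{A}$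 with eigenvalue decomposition $\bm{A}=\bm{V}\bm{\Lambda}\bm{V}^\top$, $[\bm{A}]_+=\bm{V}\bm{\Lambda}_+\bm{V}^\top$ and $[\bm{A}]_-=\bm{V}\bm{\Lambda}_-\bm{V}^\top$, where $\bm{\Lambda}_+$ and $\bm{\Lambda}_-$ keep only the positive, respectively negative, diagonal entries of $\bm{\Lambda}$ (so $\bm{A}=[\bm{A}]_++[\bm{A}]_-$). The loss $\ell:\mathbb{R}\to\mathbb{R}$ is either the hinge loss $\ell(x)=\max\{0,1-x\}$ (parameter $\gamma=0$), or, for a parameter $\gamma>0$, the smoothed hinge loss: $\ell(x)=0$ for $x>1$, $\ell(x)=\frac{1}{2\gamma}(1-x)^2$ for $1-\gamma\le x\le1$, $\ell(x)=1-x-\frac{\gamma}{2}$ for $x<1-\gamma$. The primal objective is $P_\lambda(\bm{M})=\sum_{(i,j,l)\in\mathcal{T}}\ell(\langle\bm{M},\bm{H}_{ijl}\rangle)+\frac{\lambda}{2}\|\bm{M}\|_F^2$. A subgradient $\nabla P_\lambda(\bm{M})$ is a matrix of the form $\sum_{(i,j,l)\in\mathcal{T}}g_{ijl}\bm{H}_{ijl}+\lambda\bm{M}$ with $g_{ijl}\in\partial\ell(\langle\bm{M},\bm{H}_{ijl}\rangle)$. *)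

theory Defs
  imports "HOL-Analysis.Analysis"
begin

definition frob_inner :: "real^'d^'d \<Rightarrow> real^'d^'d \<Rightarrow> real" where
  "frob_inner A B = trace (transpose A ** B)"

definition frob_norm :: "real^'d^'d \<Rightarrow> real" where
  "frob_norm A = sqrt (frob_inner A A)"

text \<open>These agree with the inner product and norm of the type \<open>real^'d^'d\<close>.\<close>

lemma frob_inner_eq_inner: "frob_inner A B = A \<bullet> B"
proof -
  have "frob_inner A B = (\<Sum>i\<in>UNIV. \<Sum>k\<in>UNIV. A $ k $ i * B $ k $ i)"
    by (simp add: frob_inner_def trace_def matrix_matrix_mult_def transpose_def)
  also have "\<dots> = A \<bullet> B"
    by (subst sum.swap) (simp add: inner_vec_def)
  finally show ?thesis .
qed

lemma frob_norm_eq_norm: "frob_norm A = norm A"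
  by (simp add: frob_norm_def frob_inner_eq_inner norm_eq_sqrt_inner)

definition psd :: "real^'d^'d \<Rightarrow> bool" where
  "psd M \<longleftrightarrow> transpose M = M \<and> (\<forall>v. 0 \<le> v \<bullet> (M *v v))"

definition outer :: "real^'d \<Rightarrow> real^'d^'d" where
  "outer v = (\<chi> i j. v $ i * v $ j)"

definition diag_mat :: "real^'d \<Rightarrow> real^'d^'d" where
  "diag_mat e = (\<chi> i j. if i = j then e $ i else 0)"

definition eigen_decomp :: "real^'d^'d \<Rightarrow> real^'d^'d \<Rightarrow> real^'d \<Rightarrow> bool" where
  "eigen_decomp A V e \<longleftrightarrow> orthogonal_matrix V \<and> A = V ** diag_mat e ** transpose V"

text \<open>Both parts are computed from the same (arbitrary) eigenvalue decomposition. For a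
  symmetric matrix a decomposition exists and the result does not depend on the choice;
  for other matrices the values below are meaningless.\<close>

definition some_eigen_decomp :: "real^'d^'d \<Rightarrow> (real^'d^'d) \<times> (real^'d)" where
  "some_eigen_decomp A = (SOME (V, e). eigen_decomp A V e)"

definition pos_part :: "real^'d^'d \<Rightarrow> real^'d^'d" where
  "pos_part A = (case some_eigen_decomp A of (V, e) \<Rightarrow>
     V ** diag_mat (\<chi> i. if e $ i > 0 then e $ i else 0) ** transpose V)"

definition neg_part :: "real^'d^'d \<Rightarrow> real^'d^'d" where
  "neg_part A = (case some_eigen_decomp A of (V, e) \<Rightarrow>
     V ** diag_mat (\<chi> i. if e $ i < 0 then e $ i else 0) ** transpose V)"

definition triplets :: "nat \<Rightarrow> (nat \<Rightarrow> 'c) \<Rightarrow> (nat \<times> nat \<times> nat) set" where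
  "triplets n y = {(i, j, l). i \<in> {1..n} \<and> j \<in> {1..n} \<and> l \<in> {1..n}
     \<and> y i = y j \<and> i \<noteq> j \<and> y i \<noteq> y l}"

fun Hmat :: "(nat \<Rightarrow> real^'d) \<Rightarrow> nat \<times> nat \<times> nat \<Rightarrow> real^'d^'d" where
  "Hmat x (i, j, l) = outer (x i - x l) - outer (x i - x j)"

text \<open>The parameter value \<open>\<gamma> = 0\<close> selects the plain hinge loss.\<close>

definition loss :: "real \<Rightarrow> real \<Rightarrow> real" where
  "loss \<gamma> x =
     (if \<gamma> = 0 then max 0 (1 - x)
      else if x > 1 then 0
      else if 1 - \<gamma> \<le> x then 1 / (2 * \<gamma>) * (1 - x)\<^sup>2
      else 1 - x - \<gamma> / 2)"

definition subdifferential :: "(real \<Rightarrow> real) \<Rightarrow> real \<Rightarrow> real set" where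
  "subdifferential f x = {g. \<forall>z. f z \<ge> f x + g * (z - x)}"

definition primal ::
  "real \<Rightarrow> nat \<Rightarrow> (nat \<Rightarrow> real^'d) \<Rightarrow> (nat \<Rightarrow> 'c) \<Rightarrow> real \<Rightarrow> real^'d^'d \<Rightarrow> real" where
  "primal \<gamma> n x y lam M =
     (\<Sum>t\<in>triplets n y. loss \<gamma> (frob_inner M (Hmat x t))) + lam / 2 * (frob_norm M)\<^sup>2"

definition primal_subgradients ::
  "real \<Rightarrow> nat \<Rightarrow> (nat \<Rightarrow> real^'d) \<Rightarrow> (nat \<Rightarrow> 'c) \<Rightarrow> real \<Rightarrow> real^'d^'d \<Rightarrow> (real^'d^'d) set" where
  "primal_subgradients \<gamma> n x y lam M =
     {(\<Sum>t\<in>triplets n y. g t *\<^sub>R Hmat x t) + lam *\<^sub>R M | g.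
        \<forall>t\<in>triplets n y. g t \<in> subdifferential (loss \<gamma>) (frob_inner M (Hmat x t))}"

text \<open>The argument \<open>G\<close> is the chosen subgradient at \<open>M\<close>.\<close>

definition Q_GB :: "real \<Rightarrow> real^'d^'d \<Rightarrow> real^'d^'d \<Rightarrow> real^'d^'d" where
  "Q_GB lam M G = M - (1 / (2 * lam)) *\<^sub>R G"

end

theory Submission imports Defs begin

text \<open>
  Strong convexity of the primal objective gives the subgradient inequality at \<open>M\<close> and quadratic
  growth at \<open>Mstar\<close>, each with the term \<open>lam / 2\<close> times the squared distance. Adding the two and
  completing the square puts \<open>Mstar\<close> in the ball with centre \<open>Q\<close> and radius
  \<open>norm G / (2 * lam)\<close>. The positive and negative parts of \<open>Q\<close> are orthogonal, and the negative
  part has nonpositive inner product with every positive semi-definite matrix, so splitting \<open>Q\<close>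
  into its parts in the squared distance from \<open>Mstar\<close> to \<open>Q\<close> gives the bound. The parts are
  meaningful because \<open>Q\<close> is symmetric; the spectral theorem is obtained by maximising the
  Rayleigh quotient on invariant subspaces.
\<close>

section \<open>Spectral theorem for real symmetric matrices\<close>

lemma inner_matrix_vector_mult_symmetric:
  fixes A :: "real^'n^'n"
  assumes "transpose A = A"
  shows "v \<bullet> (A *v w) = (A *v v) \<bullet> w"
  by (metis assms dot_lmul_matrix vector_transpose_matrix)

text \<open>The quadratic form attains its maximum on the compact unit sphere of \<open>S\<close>.
  Invariance keeps the residual of a maximiser in \<open>S\<close>, so it is an admissible direction
  of variation.\<close>

lemma symmetric_matrix_eigenvector_in_subspace:
  fixes A :: "real^'n^'n"
  assumes sym: "transpose A = A" and S: "subspace S" and inv: "\<And>v. v \<in> S \<Longrightarrow> A *v v \<in> S"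
    and nz: "S \<noteq> {0}"
  obtains u \<mu> where "u \<in> S" "norm u = 1" "A *v u = \<mu> *\<^sub>R u"
proof -
  define K where "K = S \<inter> sphere 0 1"
  have "compact K"
    unfolding K_def using closed_subspace[OF S] by (simp add: closed_Int_compact)
  moreover obtain v0 where "v0 \<in> S" "v0 \<noteq> 0"
    using nz subspace_0[OF S] by blast
  then have "(1 / norm v0) *\<^sub>R v0 \<in> K"
    by (simp add: K_def subspace_scale[OF S])
  then have "K \<noteq> {}" by blast
  moreover have "continuous_on K (\<lambda>v. v \<bullet> (A *v v))"
    by (intro continuous_intros)
  ultimately obtain u where u: "u \<in> K" and umax: "\<And>v. v \<in> K \<Longrightarrow> v \<bullet> (A *v v) \<le> u \<bullet> (A *v u)"
    using continuous_attains_sup[of K "\<lambda>v. v \<bullet> (A *v v)"] by metis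
  define \<mu> where "\<mu> = u \<bullet> (A *v u)"
  have uS: "u \<in> S" and nu: "norm u = 1"
    using u by (auto simp: K_def)
  have bound: "w \<bullet> (A *v w) \<le> \<mu> * (w \<bullet> w)" if "w \<in> S" for w
  proof (cases "w = 0")
    case False
    then have "(1 / norm w) *\<^sub>R w \<in> K"
      using that by (simp add: K_def subspace_scale[OF S])
    from umax[OF this] have "(w \<bullet> (A *v w)) / (norm w)\<^sup>2 \<le> \<mu>"
      by (simp add: \<mu>_def matrix_vector_mult_scaleR power2_eq_square)
    then show ?thesis
      using False by (simp add: divide_le_eq dot_square_norm)
  qed simp
  (* The residual w vanishes: otherwise moving from the maximiser u towards w would violate bound. *)
  define w where "w = A *v u - \<mu> *\<^sub>R u"
  have wS: "w \<in> S"
    unfolding w_def using uS by (intro subspace_diff subspace_scale S inv)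
  define k where "k = \<mu> * (w \<bullet> w) - w \<bullet> (A *v w)"
  have k0: "0 \<le> k"
    using bound[OF wS] by (simp add: k_def)
  \<comment> \<open>In \<open>bound\<close> at \<open>u + t *\<^sub>R w\<close> the constant terms
    cancel, since \<open>u\<close> attains the maximum; the first-order terms leave
    \<open>2 * t * (w \<bullet> w)\<close>.\<close>
  have ineq: "2 * t * (w \<bullet> w) \<le> t\<^sup>2 * k" for t
  proof -
    have "u + t *\<^sub>R w \<in> S"
      using uS wS by (intro subspace_add subspace_scale S)
    from bound[OF this]
    have "u \<bullet> (A *v u) + t * (u \<bullet> (A *v w)) + t * (w \<bullet> (A *v u)) + t\<^sup>2 * (w \<bullet> (A *v w))
        \<le> \<mu> * (u \<bullet> u + 2 * t * (w \<bullet> u) + t\<^sup>2 * (w \<bullet> w))"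
      by (simp add: matrix_vector_right_distrib matrix_vector_mult_scaleR inner_left_distrib
          inner_right_distrib inner_commute power2_eq_square algebra_simps)
    moreover have "u \<bullet> u = 1"
      using nu by (simp add: dot_square_norm)
    moreover have "u \<bullet> (A *v w) = w \<bullet> (A *v u)"
      using inner_matrix_vector_mult_symmetric[OF sym, of u w] by (simp add: inner_commute)
    moreover have "w \<bullet> w = w \<bullet> (A *v u) - \<mu> * (w \<bullet> u)"
      by (subst (2) w_def) (simp add: inner_diff_right)
    then have "w \<bullet> (A *v u) = w \<bullet> w + \<mu> * (w \<bullet> u)" by simp
    ultimately show ?thesis
      by (simp add: k_def \<mu>_def[symmetric] algebra_simps)
  qed
  have "w \<bullet> w = 0"
  proof -
    \<comment> \<open>With this \<open>t\<close> the right-hand side is half the left-hand side;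
      \<open>k + 1\<close> instead of \<open>k\<close> keeps the denominator positive when
      \<open>k = 0\<close>.\<close>
    have "2 * (w \<bullet> w / (k + 1)) * (w \<bullet> w) \<le> (w \<bullet> w / (k + 1))\<^sup>2 * (k + 1)"
      using ineq[of "w \<bullet> w / (k + 1)"] by (simp add: distrib_left add_increasing2)
    also have "\<dots> = (w \<bullet> w / (k + 1)) * (w \<bullet> w)"
      using k0 by (simp add: power2_eq_square)
    finally have "(w \<bullet> w)\<^sup>2 / (k + 1) \<le> 0"
      by (simp add: power2_eq_square)
    then have "(w \<bullet> w)\<^sup>2 \<le> 0"
      using k0 by (simp add: divide_le_0_iff)
    then show ?thesis by simp
  qed
  then have "A *v u = \<mu> *\<^sub>R u" by (simp add: w_def)
  with uS nu that show thesis by blast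
qed

text \<open>Induction on dimension: split off an eigenvector \<open>u\<close>. Its orthogonal
  complement in \<open>S\<close> is again invariant, because \<open>A\<close> moves across the inner
  product onto \<open>u\<close>. General invariant subspaces are needed for this descent.\<close>

lemma symmetric_matrix_orthonormal_eigenvectors:
  fixes A :: "real^'n^'n"
  assumes sym: "transpose A = A" and "subspace S" and "\<And>v. v \<in> S \<Longrightarrow> A *v v \<in> S"
  shows "\<exists>B. B \<subseteq> S \<and> pairwise orthogonal B \<and> (\<forall>b\<in>B. norm b = 1 \<and> (\<exists>c. A *v b = c *\<^sub>R b)) \<and> span B = S"
  using assms(2,3)
proof (induction "dim S" arbitrary: S rule: less_induct)
  case less
  note S = less.prems(1) and inv = less.prems(2)
  show ?case
  proof (cases "S = {0}")
    case True
    then show ?thesis by (intro exI[of _ "{}"]) simp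
  next
    case False
    obtain u \<mu> where u: "u \<in> S" "norm u = 1" "A *v u = \<mu> *\<^sub>R u"
      using symmetric_matrix_eigenvector_in_subspace[OF sym S inv False] by blast
    have uu: "u \<bullet> u = 1" using u by (simp add: dot_square_norm)
    define T where "T = S \<inter> {w. u \<bullet> w = 0}"
    have T: "subspace T"
      unfolding T_def by (intro subspace_inter S subspace_hyperplane)
    have "u \<notin> T" using uu by (simp add: T_def)
    then have "T \<subset> S" using u(1) by (auto simp only: T_def)
    then have "dim T < dim S"
      using S T by (metis dim_psubset span_eq_iff)
    moreover have "A *v w \<in> T" if "w \<in> T" for w
      using that inv u by (simp add: T_def inner_matrix_vector_mult_symmetric[OF sym])
    ultimately obtain B where B: "B \<subseteq> T" "pairwise orthogonal B"
      "\<forall>b\<in>B. norm b = 1 \<and> (\<exists>c. A *v b = c *\<^sub>R b)" "span B = T"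
      using less.hyps[of T] T by blast
    have "S \<subseteq> span (insert u B)"
    proof
      fix w assume "w \<in> S"
      then have "w - (u \<bullet> w) *\<^sub>R u \<in> T"
        using u uu S by (simp add: T_def subspace_diff subspace_scale inner_diff_right)
      then show "w \<in> span (insert u B)"
        using B(4) span_breakdown_eq by blast
    qed
    moreover have "span (insert u B) \<subseteq> S"
      using B(1) u(1) S by (intro span_minimal) (auto simp: T_def)
    moreover have "pairwise orthogonal (insert u B)"
      using B(1,2) by (auto simp: pairwise_insert T_def orthogonal_def inner_commute)
    moreover have "insert u B \<subseteq> S"
      using B(1) u(1) by (auto simp: T_def)
    ultimately show ?thesis
      using B(3) u by (intro exI[of _ "insert u B"]) blast
  qed
qed

lemma matrix_mul_diag_mat: "(V ** diag_mat e) $ i $ j = V $ i $ j * e $ j"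
  by (simp add: matrix_matrix_mult_def diag_mat_def if_distrib cong: if_cong)

lemma eigen_decomp_exists:
  fixes A :: "real^'n^'n"
  assumes sym: "transpose A = A"
  shows "\<exists>V e. eigen_decomp A V e"
proof -
  obtain B where B: "pairwise orthogonal B"
    "\<forall>b\<in>B. norm b = 1 \<and> (\<exists>c. A *v b = c *\<^sub>R b)" "span B = (UNIV :: (real^'n) set)"
    using symmetric_matrix_orthonormal_eigenvectors[OF sym subspace_UNIV] by auto
  have "independent B"
    using B(1,2) by (intro pairwise_orthogonal_independent) auto
  then have fB: "finite B" and "card B = CARD('n)"
    using B(3) by (auto simp: finiteI_independent dim_eq_card[of B UNIV] dest!: dim_eq_card[of B UNIV, rotated])
  then obtain f where f: "bij_betw f (UNIV :: 'n set) B"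
    using finite_same_card_bij[of "UNIV :: 'n set" B] by auto
  have fin: "f i \<in> B" for i using f by (auto simp: bij_betw_def)
  have "\<forall>i. \<exists>c. A *v f i = c *\<^sub>R f i" using B(2) fin by blast
  then obtain c where c: "\<And>i. A *v f i = c i *\<^sub>R f i" by metis
  define V :: "real^'n^'n" where "V = (\<chi> i j. f j $ i)"
  define e :: "real^'n" where "e = (\<chi> i. c i)"
  have col: "column j V = f j" for j
    by (simp add: V_def column_def vec_eq_iff)
  have "orthogonal_matrix V"
    unfolding orthogonal_matrix_orthonormal_columns col
  proof (intro conjI allI impI)
    show "norm (f i) = 1" for i using B(2) fin by blast
    show "orthogonal (f i) (f j)" if "i \<noteq> j" for i j
      using B(1) fin f that by (metis UNIV_I bij_betw_def inj_onD pairwiseD)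
  qed
  \<comment> \<open>Column \<open>j\<close> of this identity is the eigenvalue equation of
    \<open>f j\<close>.\<close>
  moreover have "A ** V = V ** diag_mat e"
  proof (simp only: vec_eq_iff, intro allI)
    fix i j
    have "(A ** V) $ i $ j = (A *v f j) $ i"
      by (simp add: matrix_matrix_mult_def matrix_vector_mult_def V_def)
    also have "\<dots> = V $ i $ j * e $ j"
      by (simp add: c V_def e_def)
    finally show "(A ** V) $ i $ j = (V ** diag_mat e) $ i $ j"
      by (simp add: matrix_mul_diag_mat)
  qed
  ultimately have "A = V ** diag_mat e ** transpose V"
    by (metis matrix_mul_assoc matrix_mul_rid orthogonal_matrix_def)
  with \<open>orthogonal_matrix V\<close> show ?thesis
    unfolding eigen_decomp_def by blast
qed

section \<open>Positive and negative parts\<close>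

text \<open>Reduces inner products with a spectral form to values of the quadratic form of
  \<open>M\<close> on the columns of \<open>V\<close>, from which both orthogonality and signs can
  be read off.\<close>

lemma inner_eigen_form:
  fixes M V :: "real^'n^'n"
  shows "M \<bullet> (V ** diag_mat e ** transpose V) = (\<Sum>k\<in>UNIV. e $ k * (column k V \<bullet> (M *v column k V)))"
proof -
  have entry: "(V ** diag_mat e ** transpose V) $ i $ j = (\<Sum>k\<in>UNIV. V $ i $ k * e $ k * V $ j $ k)" for i j
    by (simp add: matrix_matrix_mult_def[of "V ** diag_mat e"] matrix_mul_diag_mat transpose_def)
  have "M \<bullet> (V ** diag_mat e ** transpose V)
      = (\<Sum>i\<in>UNIV. \<Sum>j\<in>UNIV. \<Sum>k\<in>UNIV. e $ k * (V $ i $ k * (M $ i $ j * V $ j $ k)))"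
    by (simp add: inner_vec_def entry sum_distrib_left mult_ac)
  also have "\<dots> = (\<Sum>i\<in>UNIV. \<Sum>k\<in>UNIV. \<Sum>j\<in>UNIV. e $ k * (V $ i $ k * (M $ i $ j * V $ j $ k)))"
    by (intro sum.cong refl sum.swap)
  also have "\<dots> = (\<Sum>k\<in>UNIV. \<Sum>i\<in>UNIV. \<Sum>j\<in>UNIV. e $ k * (V $ i $ k * (M $ i $ j * V $ j $ k)))"
    by (rule sum.swap)
  also have "\<dots> = (\<Sum>k\<in>UNIV. e $ k * (column k V \<bullet> (M *v column k V)))"
    by (simp add: inner_vec_def matrix_vector_mult_def column_def sum_distrib_left)
  finally show ?thesis .
qed

lemma eigen_form_mult_column:
  fixes V :: "real^'n^'n"
  assumes "orthogonal_matrix V"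
  shows "(V ** diag_mat e ** transpose V) *v column k V = e $ k *\<^sub>R column k V"
proof -
  have "(V ** diag_mat e ** transpose V) ** V = V ** diag_mat e"
    using assms by (metis matrix_mul_assoc matrix_mul_rid orthogonal_matrix)
  then have "((V ** diag_mat e ** transpose V) ** V) $ i $ k = V $ i $ k * e $ k" for i
    by (simp add: matrix_mul_diag_mat)
  then show ?thesis
    by (simp add: vec_eq_iff matrix_vector_mult_def matrix_matrix_mult_def[of _ V] column_def mult.commute)
qed

lemma pos_neg_part:
  fixes A M :: "real^'n^'n"
  assumes "transpose A = A"
  shows pos_part_plus_neg_part: "pos_part A + neg_part A = A"
    and inner_pos_part_neg_part: "pos_part A \<bullet> neg_part A = 0"
    and psd_inner_neg_part_nonpos: "psd M \<Longrightarrow> M \<bullet> neg_part A \<le> 0"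
proof -
  obtain V e where Ve: "some_eigen_decomp A = (V, e)" by fastforce
  have "eigen_decomp A V e"
    using someI_ex[of "\<lambda>(V, e). eigen_decomp A V e"] eigen_decomp_exists[OF assms] Ve
    unfolding some_eigen_decomp_def by auto
  then have V: "orthogonal_matrix V" and A: "A = V ** diag_mat e ** transpose V"
    by (auto simp: eigen_decomp_def)
  define p where "p = (\<chi> i. if e $ i > 0 then e $ i else 0)"
  define m where "m = (\<chi> i. if e $ i < 0 then e $ i else 0)"
  have pos: "pos_part A = V ** diag_mat p ** transpose V"
    and neg: "neg_part A = V ** diag_mat m ** transpose V"
    by (simp_all add: pos_part_def neg_part_def Ve p_def m_def)
  have "diag_mat p + diag_mat m = diag_mat e"
    by (simp add: vec_eq_iff diag_mat_def p_def m_def)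
  moreover have "(B + C) ** D = B ** D + C ** D" for B C D :: "real^'n^'n"
    by (simp add: matrix_matrix_mult_def vec_eq_iff sum.distrib distrib_right)
  ultimately show "pos_part A + neg_part A = A"
    unfolding pos neg by (metis A matrix_add_ldistrib)
  \<comment> \<open>The columns of \<open>V\<close> are eigenvectors of both parts, so each summand
    contains the product of \<open>p $ k\<close> and \<open>m $ k\<close>, one of which is
    zero.\<close>
  show "pos_part A \<bullet> neg_part A = 0"
    unfolding neg inner_eigen_form pos eigen_form_mult_column[OF V]
    by (intro sum.neutral) (simp add: p_def m_def)
  show "M \<bullet> neg_part A \<le> 0" if "psd M"
    unfolding neg inner_eigen_form using that
    by (intro sum_nonpos mult_nonpos_nonneg) (auto simp: m_def psd_def)
qed

section \<open>Subgradients and strong convexity of the primal objective\<close>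

text \<open>Quadratic growth at the minimiser uses subgradients at points of a segment, where none
  is given in advance.\<close>

lemma subdifferential_loss_nonempty:
  assumes "\<gamma> \<ge> 0"
  shows "subdifferential (loss \<gamma>) x \<noteq> {}"
proof (cases "\<gamma> = 0")
  case True
  \<comment> \<open>The slope to the left of the kink is \<open>-1\<close>; at the kink itself
    \<open>0\<close> is chosen.\<close>
  then have "(if x < 1 then -1 else 0) \<in> subdifferential (loss \<gamma>) x"
    by (simp add: subdifferential_def loss_def)
  then show ?thesis by blast
next
  case False
  then have \<gamma>: "\<gamma> > 0" using assms by simp
  (* The loss is the conjugate form max over a in [0,1] of a (1 - z) - \<gamma> a^2 / 2. *)
  have lower: "a * (1 - z) - \<gamma> * a\<^sup>2 / 2 \<le> loss \<gamma> z" if a: "0 \<le> a" "a \<le> 1" for a z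
  proof -
    consider "z > 1" | "1 - \<gamma> \<le> z" "z \<le> 1" | "z < 1 - \<gamma>" "z \<le> 1" using \<gamma> by linarith
    then show ?thesis
    proof cases
      case 1
      then have "a * (1 - z) \<le> 0" using a by (simp add: mult_nonneg_nonpos)
      moreover have "0 \<le> \<gamma> * a\<^sup>2" using \<gamma> by simp
      ultimately have "a * (1 - z) - \<gamma> * a\<^sup>2 / 2 \<le> 0" by linarith
      then show ?thesis using 1 \<gamma> by (simp add: loss_def)
    next
      case 2
      \<comment> \<open>The gap between the two sides is a perfect square.\<close>
      have "0 \<le> (1 - z - \<gamma> * a)\<^sup>2 / (2 * \<gamma>)" using \<gamma> by simp
      also have "\<dots> = 1 / (2 * \<gamma>) * (1 - z)\<^sup>2 - (a * (1 - z) - \<gamma> * a\<^sup>2 / 2)"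
        using \<gamma> by (simp add: field_simps power2_eq_square)
      finally show ?thesis using 2 \<gamma> by (simp add: loss_def)
    next
      case 3
      have "0 \<le> (1 - a) * (1 - z - \<gamma>) + \<gamma> * (1 - a)\<^sup>2 / 2"
        using a 3 \<gamma> by (intro add_nonneg_nonneg mult_nonneg_nonneg) auto
      also have "\<dots> = 1 - z - \<gamma> / 2 - (a * (1 - z) - \<gamma> * a\<^sup>2 / 2)"
        by (simp add: field_simps power2_eq_square)
      finally show ?thesis using 3 \<gamma> by (simp add: loss_def)
    qed
  qed
  \<comment> \<open>The maximiser of the conjugate form at \<open>x\<close>:
    \<open>(1 - x) / \<gamma>\<close> clipped to the unit interval. Its negative is the slope of the
    loss at \<open>x\<close>.\<close>
  define a where "a = (if x > 1 then 0 else if 1 - \<gamma> \<le> x then (1 - x) / \<gamma> else 1)"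
  have "0 \<le> a" "a \<le> 1" using \<gamma> by (auto simp: a_def divide_le_eq)
  moreover have "loss \<gamma> x = a * (1 - x) - \<gamma> * a\<^sup>2 / 2"
    using \<gamma> by (simp add: a_def loss_def field_simps power2_eq_square)
  ultimately have "loss \<gamma> x + - a * (z - x) \<le> loss \<gamma> z" for z
    using lower[of a z] by (simp add: algebra_simps)
  then have "- a \<in> subdifferential (loss \<gamma>) x"
    by (simp add: subdifferential_def)
  then show ?thesis by blast
qed

text \<open>The loss terms contribute their subgradient inequalities; the regulariser expands
  exactly around \<open>M\<close>, which produces the quadratic term.\<close>

lemma primal_subgradient_ineq:
  assumes "G \<in> primal_subgradients \<gamma> n x y lam M"
  shows "primal \<gamma> n x y lam N \<ge> primal \<gamma> n x y lam M + G \<bullet> (N - M) + lam / 2 * (norm (N - M))\<^sup>2"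
proof -
  obtain g where G: "G = (\<Sum>t\<in>triplets n y. g t *\<^sub>R Hmat x t) + lam *\<^sub>R M"
    and g: "\<And>t. t \<in> triplets n y \<Longrightarrow> g t \<in> subdifferential (loss \<gamma>) (M \<bullet> Hmat x t)"
    using assms by (auto simp: primal_subgradients_def frob_inner_eq_inner)
  have "(\<Sum>t\<in>triplets n y. loss \<gamma> (M \<bullet> Hmat x t) + g t * (N \<bullet> Hmat x t - M \<bullet> Hmat x t))
      \<le> (\<Sum>t\<in>triplets n y. loss \<gamma> (N \<bullet> Hmat x t))"
    using g by (intro sum_mono) (simp add: subdifferential_def)
  moreover have "G \<bullet> (N - M) = (\<Sum>t\<in>triplets n y. g t * (N \<bullet> Hmat x t - M \<bullet> Hmat x t)) + lam * (M \<bullet> (N - M))"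
    by (simp add: G inner_left_distrib inner_sum_left inner_diff_right inner_commute[of _ "Hmat x t" for t]
        right_diff_distrib sum_subtractf)
  moreover have "lam / 2 * (norm N)\<^sup>2 = lam / 2 * (norm M)\<^sup>2 + lam * (M \<bullet> (N - M)) + lam / 2 * (norm (N - M))\<^sup>2"
    by (simp add: power2_norm_eq_inner inner_diff_left inner_diff_right inner_commute algebra_simps)
  ultimately show ?thesis
    unfolding primal_def frob_inner_eq_inner frob_norm_eq_norm sum.distrib by linarith
qed

lemma psd_convex_combination:
  assumes "psd M" "psd N" "0 \<le> t" "t \<le> 1"
  shows "psd ((1 - t) *\<^sub>R M + t *\<^sub>R N)"
proof -
  have "transpose ((1 - t) *\<^sub>R M + t *\<^sub>R N) = (1 - t) *\<^sub>R transpose M + t *\<^sub>R transpose N"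
    by (simp add: transpose_def vec_eq_iff)
  then show ?thesis
    using assms
    by (simp add: psd_def matrix_vector_mult_add_rdistrib scaleR_matrix_vector_assoc[symmetric]
        inner_right_distrib)
qed

text \<open>Strong convexity along the segment from \<open>Mstar\<close> to \<open>M\<close>,
  combined with minimality of \<open>Mstar\<close> at the intermediate point, gives the bound with
  the factor \<open>1 - t\<close>; then \<open>t\<close> tends to \<open>0\<close>.\<close>

lemma primal_quadratic_growth:
  assumes "\<gamma> \<ge> 0" and "lam > 0"
    and min: "is_arg_min (primal \<gamma> n x y lam) psd Mstar" and M: "psd M"
  shows "primal \<gamma> n x y lam M \<ge> primal \<gamma> n x y lam Mstar + lam / 2 * (norm (M - Mstar))\<^sup>2"
proof -
  define P where "P = primal \<gamma> n x y lam"
  define D where "D = (norm (M - Mstar))\<^sup>2"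
  have psds: "psd Mstar" and opt: "\<And>N. psd N \<Longrightarrow> P Mstar \<le> P N"
    using min by (auto simp: is_arg_min_def P_def not_less)
  have step: "lam / 2 * (1 - t) * D \<le> P M - P Mstar" if t: "0 < t" "t < 1" for t
  proof -
    define N where "N = (1 - t) *\<^sub>R Mstar + t *\<^sub>R M"
    have "\<forall>s. \<exists>g. g \<in> subdifferential (loss \<gamma>) (frob_inner N (Hmat x s))"
      using subdifferential_loss_nonempty[OF assms(1)] by blast
    then obtain g where "\<And>s. g s \<in> subdifferential (loss \<gamma>) (frob_inner N (Hmat x s))"
      by metis
    then obtain G where G: "G \<in> primal_subgradients \<gamma> n x y lam N"
      unfolding primal_subgradients_def by blast
    note ineq = primal_subgradient_ineq[OF G, folded P_def]
    have d1: "M - N = (1 - t) *\<^sub>R (M - Mstar)" and d2: "Mstar - N = (- t) *\<^sub>R (M - Mstar)"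
      by (simp_all add: N_def algebra_simps)
    have 1: "P M \<ge> P N + (1 - t) * (G \<bullet> (M - Mstar)) + lam / 2 * ((1 - t)\<^sup>2 * D)"
      using ineq[of M] by (simp only: d1 inner_scaleR_right norm_scaleR power_mult_distrib power2_abs D_def)
    have 2: "P Mstar \<ge> P N + (- t) * (G \<bullet> (M - Mstar)) + lam / 2 * (t\<^sup>2 * D)"
      using ineq[of Mstar]
      by (simp only: d2 inner_scaleR_right norm_scaleR power_mult_distrib power2_abs D_def power2_minus)
    \<comment> \<open>Weights \<open>t\<close> on \<open>1\<close> and \<open>1 - t\<close> on
      \<open>2\<close> cancel the terms linear in \<open>G\<close>; the quadratic coefficients add
      up to \<open>t * (1 - t)\<close>.\<close>
    have "(1 - t) * P Mstar + t * P M \<ge> P N + lam / 2 * (t * (1 - t) * D)"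
      using mult_left_mono[OF 1, of t] mult_left_mono[OF 2, of "1 - t"] t
      by (simp add: field_simps power2_eq_square)
    moreover have "P Mstar \<le> P N"
      unfolding N_def using t psds M by (intro opt psd_convex_combination) auto
    ultimately have "t * (lam / 2 * (1 - t) * D) \<le> t * (P M - P Mstar)"
      by (simp add: algebra_simps diff_divide_distrib)
    then show ?thesis using t by simp
  qed
  \<comment> \<open>The limit from the right recovers the full constant
    \<open>lam / 2\<close>.\<close>
  have "((\<lambda>t. lam / 2 * (1 - t) * D) \<longlongrightarrow> lam / 2 * (1 - 0) * D) (at_right 0)"
    by (intro tendsto_intros)
  moreover have "\<forall>\<^sub>F t in at_right 0. lam / 2 * (1 - t) * D \<le> P M - P Mstar"
    using step by (auto simp: eventually_at_right_field intro!: exI[of _ 1])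
  ultimately have "lam / 2 * (1 - 0) * D \<le> P M - P Mstar"
    by (intro tendsto_upperbound) auto
  then show ?thesis by (simp add: P_def D_def)
qed

section \<open>Symmetry of the centre and the final bound\<close>

text \<open>Makes \<open>Q_GB lam M G\<close> symmetric, so that its spectral parts are
  meaningful.\<close>

lemma transpose_subgradient:
  assumes "G \<in> primal_subgradients \<gamma> n x y lam M" and "transpose M = M"
  shows "transpose G = G"
proof -
  have H: "Hmat x t $ i $ j = Hmat x t $ j $ i" for t i j
    by (cases t) (simp add: outer_def mult.commute)
  have M: "M $ i $ j = M $ j $ i" for i j
    using assms(2) by (metis transpose_def vec_lambda_beta)
  obtain g where G: "G = (\<Sum>t\<in>triplets n y. g t *\<^sub>R Hmat x t) + lam *\<^sub>R M"
    using assms(1) by (auto simp: primal_subgradients_def)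
  have "G $ j $ i = G $ i $ j" for i j
    by (simp add: G H[of _ j i] M[of j i])
  then show ?thesis
    by (simp add: transpose_def vec_eq_iff)
qed

theorem theorem3p3:
  fixes x :: "nat \<Rightarrow> real^'d" and y :: "nat \<Rightarrow> 'c" and n :: nat
    and \<gamma> lam :: real and Mstar M G :: "real^'d^'d"
  assumes "\<gamma> \<ge> 0"
    and "lam > 0"
    and "is_arg_min (primal \<gamma> n x y lam) psd Mstar"
    and "psd M"
    and "G \<in> primal_subgradients \<gamma> n x y lam M"
  shows "(frob_norm (Mstar - pos_part (Q_GB lam M G)))\<^sup>2
    \<le> (1 / (2 * lam) * frob_norm G)\<^sup>2 - (frob_norm (neg_part (Q_GB lam M G)))\<^sup>2"
proof -
  define Q where "Q = Q_GB lam M G"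
  have "transpose M = M" using assms(4) by (simp add: psd_def)
  with transpose_subgradient[OF assms(5)] have "transpose Q = Q"
    by (simp add: Q_def Q_GB_def transpose_def vec_eq_iff)
  note parts = pos_neg_part[OF this]
  have "lam * (norm (Mstar - M))\<^sup>2 + G \<bullet> (Mstar - M) \<le> 0"
    using primal_subgradient_ineq[OF assms(5), of Mstar] primal_quadratic_growth[OF assms(1-4)]
    by (simp add: norm_minus_commute)
  then have "(lam * (norm (Mstar - M))\<^sup>2 + G \<bullet> (Mstar - M)) / lam \<le> 0"
    using assms(2) by (simp add: divide_le_0_iff)
  \<comment> \<open>Completing the square: the shift \<open>1 / (2 * lam)\<close> turns the cross
    term into \<open>G \<bullet> (Mstar - M) / lam\<close>.\<close>
  moreover have "(norm (Mstar - Q))\<^sup>2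
      = (lam * (norm (Mstar - M))\<^sup>2 + G \<bullet> (Mstar - M)) / lam + (1 / (2 * lam) * norm G)\<^sup>2"
  proof -
    have "(norm (D + c *\<^sub>R G))\<^sup>2 = (norm D)\<^sup>2 + 2 * (c * (G \<bullet> D)) + c\<^sup>2 * (norm G)\<^sup>2" for D c
      unfolding power2_norm_eq_inner
      by (simp add: inner_left_distrib inner_right_distrib inner_commute power2_eq_square)
    moreover have "Mstar - Q = (Mstar - M) + (1 / (2 * lam)) *\<^sub>R G"
      by (simp add: Q_def Q_GB_def)
    ultimately have "(norm (Mstar - Q))\<^sup>2 = (norm (Mstar - M))\<^sup>2 + 2 * (1 / (2 * lam) * (G \<bullet> (Mstar - M)))
        + (1 / (2 * lam))\<^sup>2 * (norm G)\<^sup>2"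
      by metis
    then show ?thesis
      using assms(2) by (simp add: add_divide_distrib power_mult_distrib power_divide)
  qed
  ultimately have ball: "(norm (Mstar - Q))\<^sup>2 \<le> (1 / (2 * lam) * norm G)\<^sup>2"
    by linarith
  have "Mstar - Q = (Mstar - pos_part Q) - neg_part Q"
    by (subst parts(1)[symmetric]) simp
  moreover have "(norm (Mstar - X - Y))\<^sup>2 = (norm (Mstar - X))\<^sup>2 + (norm Y)\<^sup>2 - 2 * (Mstar \<bullet> Y)"
    if "X \<bullet> Y = 0" for X Y
    using that unfolding power2_norm_eq_inner
    by (simp add: inner_diff_left inner_diff_right inner_commute)
  ultimately have "(norm (Mstar - Q))\<^sup>2 = (norm (Mstar - pos_part Q))\<^sup>2 + (norm (neg_part Q))\<^sup>2
      - 2 * (Mstar \<bullet> neg_part Q)"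
    using parts(2) by metis
  moreover have "Mstar \<bullet> neg_part Q \<le> 0"
    using assms(3) by (intro parts(3)) (simp add: is_arg_min_def)
  ultimately show ?thesis
    using ball by (simp add: frob_norm_eq_norm Q_def)
qed

end
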